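(* Let $\mu,\sigma>0$ be constants, let $N\ge1$, $\delta_1,\dots,\delta_N>0$ and weights $\omega_1,\dots,\omega_N>0$ with $\sum_{i=1}^N\omega_i=1$. For sufficiently large $M$, let $b(M)>0$ be the unique equilibrium barrier point in the bounded dividend rate case with rate bound $M$, satisfying $$\sum_{i=1}^N\omega_iV_i'(b(M),M)=1 .$$ Let $k^*>0$ be the equilibrium barrier of the singular dividend control problem under linear aggregation, satisfying $$G(k^* )=\sum_{i=1}^N\omega_i\big(\mu-\delta_ih(k^*,\delta_i)\big)=0 .$$ Then $\lim_{M\to\infty}b(M)=k^*$.
   Context: For $r>0$ set $\lambda_\pm(r)=\dfrac{-\mu\pm\sqrt{\mu^2+2\sigma^2r}}{\sigma^2}$ and $h(k,r)=\dfrac{e^{\lambda_+(r)k}-e^{\lambda_-(r)k}}{\lambda_+(r)e^{\lambda_+(r)k}-\lambda_-(r)e^{\lambda_-(r)k}}$. Surplus with dividends $D$: $\mathrm dX_t=\mu\,\mathrm dt+\sigma\,\mathrm dW_t-\mathrm dD_t$. The (mixture of exponentials) discount function is $\sum_{i=1}^N\omega_ie^{-\delta_it}$, i.e. the discount-rate distribution $F_\rho$ puts mass $\omega_i$ at $\delta_i$, and aggregation is linear, $\phi(x)=x$. Bounded dividend rate case: dividends are $D_t=\int_0^t\ell_s\,\mathrm ds$ with $\ell_s\in[0,M]$. For $M$ sufficiently large the equilibrium strategy is $\ell^*(x)=0$ for $0\le x<b$ and $\ell^*(x)=M$ for $x\ge b$, where $b=b(M)>0$ is the unique positive barrier, determined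 by $\sum_i\omega_iV_i'(b,M)=1$ with $$V_i'(b,M)=\frac{M\theta_{i3}}{\delta_i}\cdot\frac{\lambda_+(\delta_i)e^{\lambda_+(\delta_i)b}-\lambda_-(\delta_i)e^{\lambda_-(\delta_i)b}}{(\lambda_+(\delta_i)+\theta_{i3})e^{\lambda_+(\delta_i)b}-(\lambda_-(\delta_i)+\theta_{i3})e^{\lambda_-(\delta_i)b}},$$ where $-\theta_{i3}$ is the negative root of $\frac12\sigma^2y^2+(\mu-M)y-\delta_i=0$ (existence and uniqueness of $b(M)$ for large $M$ is part of the setting). Singular case: dividends are general nondecreasing right-continuous processes; the barrier-type equilibrium with no-transaction region $(0,k^* )$ and pay region $[k^*,\infty)$ has its barrier $k^*$ given by the unique solution in $(0,\infty)$ of $G(k)=0$, $G(k)=\sum_i\omega_i(\mu-\delta_ih(k,\delta_i))$. *)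

theory Defs
  imports Complex_Main
begin

text \<open>The model parameters are the drift mu and volatility sigma of the surplus; the discount
  function is the mixture \<open>\<Sum>i = 1..N. \<omega> i * exp (- \<delta> i * t)\<close>, with linear aggregation.\<close>

definition lambda_plus :: "real \<Rightarrow> real \<Rightarrow> real \<Rightarrow> real" where
  "lambda_plus \<mu> \<sigma> r = (- \<mu> + sqrt (\<mu>\<^sup>2 + 2 * \<sigma>\<^sup>2 * r)) / \<sigma>\<^sup>2"

definition lambda_minus :: "real \<Rightarrow> real \<Rightarrow> real \<Rightarrow> real" where
  "lambda_minus \<mu> \<sigma> r = (- \<mu> - sqrt (\<mu>\<^sup>2 + 2 * \<sigma>\<^sup>2 * r)) / \<sigma>\<^sup>2"

definition h :: "real \<Rightarrow> real \<Rightarrow> real \<Rightarrow> real \<Rightarrow> real" where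
  "h \<mu> \<sigma> k r =
     (exp (lambda_plus \<mu> \<sigma> r * k) - exp (lambda_minus \<mu> \<sigma> r * k)) /
     (lambda_plus \<mu> \<sigma> r * exp (lambda_plus \<mu> \<sigma> r * k)
        - lambda_minus \<mu> \<sigma> r * exp (lambda_minus \<mu> \<sigma> r * k))"

definition theta3 :: "real \<Rightarrow> real \<Rightarrow> real \<Rightarrow> real \<Rightarrow> real" where
  "theta3 \<mu> \<sigma> M d = - (THE y. y < 0 \<and> 1 / 2 * \<sigma>\<^sup>2 * y\<^sup>2 + (\<mu> - M) * y - d = 0)"

text \<open>The description in \<open>theta3\<close> is proper, for every rate bound \<open>M\<close>:\<close>

lemma theta3_ex1:
  fixes \<mu> \<sigma> M d :: real
  assumes "\<sigma> > 0" and "d > 0"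
  shows "\<exists>!y. y < 0 \<and> 1 / 2 * \<sigma>\<^sup>2 * y\<^sup>2 + (\<mu> - M) * y - d = 0"
proof -
  define s where "s = sqrt ((\<mu> - M)\<^sup>2 + 2 * \<sigma>\<^sup>2 * d)"
  have p: "\<sigma>\<^sup>2 > 0" using assms by simp
  have pd: "2 * \<sigma>\<^sup>2 * d > 0" using p assms by simp
  have s2: "s\<^sup>2 = (\<mu> - M)\<^sup>2 + 2 * \<sigma>\<^sup>2 * d"
    unfolding s_def using pd by (simp add: add_nonneg_pos less_imp_le)
  have "sqrt ((\<mu> - M)\<^sup>2) < s" unfolding s_def using pd by (intro real_sqrt_less_mono) simp
  hence sgt: "\<bar>\<mu> - M\<bar> < s" by simp
  have root: "1 / 2 * \<sigma>\<^sup>2 * y\<^sup>2 + (\<mu> - M) * y - d = 0 \<longleftrightarrow>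
      \<sigma>\<^sup>2 * y + (\<mu> - M) = s \<or> \<sigma>\<^sup>2 * y + (\<mu> - M) = - s" for y
  proof -
    have "(\<sigma>\<^sup>2 * y + (\<mu> - M))\<^sup>2 - s\<^sup>2 =
        2 * \<sigma>\<^sup>2 * (1 / 2 * \<sigma>\<^sup>2 * y\<^sup>2 + (\<mu> - M) * y - d)"
      unfolding s2 by (simp add: power2_eq_square algebra_simps)
    hence "1 / 2 * \<sigma>\<^sup>2 * y\<^sup>2 + (\<mu> - M) * y - d = 0 \<longleftrightarrow> (\<sigma>\<^sup>2 * y + (\<mu> - M))\<^sup>2 = s\<^sup>2"
      using p by auto
    thus ?thesis by (simp add: power2_eq_iff)
  qed
  show ?thesis
  proof (rule ex1I)
    let ?y = "(- s - (\<mu> - M)) / \<sigma>\<^sup>2"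
    have "?y < 0" using sgt p by (simp add: divide_less_0_iff)
    moreover have "\<sigma>\<^sup>2 * ?y + (\<mu> - M) = - s" using p by simp
    ultimately show "?y < 0 \<and> 1 / 2 * \<sigma>\<^sup>2 * ?y\<^sup>2 + (\<mu> - M) * ?y - d = 0"
      using root by blast
  next
    fix y assume y: "y < 0 \<and> 1 / 2 * \<sigma>\<^sup>2 * y\<^sup>2 + (\<mu> - M) * y - d = 0"
    hence "\<sigma>\<^sup>2 * y < 0" using p by (simp add: mult_pos_neg)
    hence "\<sigma>\<^sup>2 * y + (\<mu> - M) \<noteq> s" using sgt by linarith
    hence "\<sigma>\<^sup>2 * y + (\<mu> - M) = - s" using y root by blast
    thus "y = (- s - (\<mu> - M)) / \<sigma>\<^sup>2" using p by (simp add: field_simps)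
  qed
qed

text \<open>\<open>V_deriv \<mu> \<sigma> d b M\<close> is the derivative in the surplus, taken at the barrier \<open>b\<close>, of the
  value of paying dividends at rate \<open>M\<close> above \<open>b\<close> and nothing below, under the constant
  discount rate \<open>d\<close>.\<close>

definition V_deriv :: "real \<Rightarrow> real \<Rightarrow> real \<Rightarrow> real \<Rightarrow> real \<Rightarrow> real" where
  "V_deriv \<mu> \<sigma> d b M =
     M * theta3 \<mu> \<sigma> M d / d *
     ((lambda_plus \<mu> \<sigma> d * exp (lambda_plus \<mu> \<sigma> d * b)
         - lambda_minus \<mu> \<sigma> d * exp (lambda_minus \<mu> \<sigma> d * b)) /
      ((lambda_plus \<mu> \<sigma> d + theta3 \<mu> \<sigma> M d) * exp (lambda_plus \<mu> \<sigma> d * b)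
         - (lambda_minus \<mu> \<sigma> d + theta3 \<mu> \<sigma> M d) * exp (lambda_minus \<mu> \<sigma> d * b)))"

definition G :: "real \<Rightarrow> real \<Rightarrow> nat \<Rightarrow> (nat \<Rightarrow> real) \<Rightarrow> (nat \<Rightarrow> real) \<Rightarrow> real \<Rightarrow> real" where
  "G \<mu> \<sigma> N \<omega> \<delta> k = (\<Sum>i = 1..N. \<omega> i * (\<mu> - \<delta> i * h \<mu> \<sigma> k (\<delta> i)))"

text \<open>Both equilibrium barriers are given as the unique positive solution of their equation.\<close>

definition bounded_rate_barrier ::
  "real \<Rightarrow> real \<Rightarrow> nat \<Rightarrow> (nat \<Rightarrow> real) \<Rightarrow> (nat \<Rightarrow> real) \<Rightarrow> real \<Rightarrow> real \<Rightarrow> bool" where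
  "bounded_rate_barrier \<mu> \<sigma> N \<omega> \<delta> M b \<longleftrightarrow>
     b > 0 \<and> (\<Sum>i = 1..N. \<omega> i * V_deriv \<mu> \<sigma> (\<delta> i) b M) = 1 \<and>
     (\<forall>b'>0. (\<Sum>i = 1..N. \<omega> i * V_deriv \<mu> \<sigma> (\<delta> i) b' M) = 1 \<longrightarrow> b' = b)"

definition singular_barrier ::
  "real \<Rightarrow> real \<Rightarrow> nat \<Rightarrow> (nat \<Rightarrow> real) \<Rightarrow> (nat \<Rightarrow> real) \<Rightarrow> real \<Rightarrow> bool" where
  "singular_barrier \<mu> \<sigma> N \<omega> \<delta> k \<longleftrightarrow>
     k > 0 \<and> G \<mu> \<sigma> N \<omega> \<delta> k = 0 \<and> (\<forall>k'>0. G \<mu> \<sigma> N \<omega> \<delta> k' = 0 \<longrightarrow> k' = k)"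

end

theory Submission
  imports Defs
begin

text \<open>
  Write \<open>\<theta>\<close> for \<open>theta3 \<mu> \<sigma> M d\<close> and \<open>h\<close> for \<open>h \<mu> \<sigma> k d\<close>.  Dividing numerator and denominator of
  \<open>V_deriv\<close> by \<open>\<lambda>\<^sub>+ e\<^bsup>\<lambda>\<^sub>+ k\<^esup> - \<lambda>\<^sub>- e\<^bsup>\<lambda>\<^sub>- k\<^esup>\<close> gives \<open>V' = (M \<theta> / d) / (1 + \<theta> h)\<close>
  (\<open>V_deriv_eq\<close>), and the quadratic equation of \<open>\<theta>\<close> says \<open>M \<theta> = d + \<mu> \<theta> - \<sigma>\<^sup>2 \<theta>\<^sup>2 / 2\<close>.  Together,
  \<open>M (V' - 1) = (M \<theta> / d) (\<mu> - d h - \<sigma>\<^sup>2 \<theta> / 2) / (1 + \<theta> h)\<close>.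
  As \<open>M \<rightarrow> \<infinity>\<close> we have \<open>\<theta> \<rightarrow> 0\<close> and \<open>M \<theta> \<rightarrow> d\<close>, so the right-hand side tends to \<open>\<mu> - d h\<close>.  Thus the
  bounded-rate equation, in the form \<open>M (\<Sum>\<omega>\<^sub>i V\<^sub>i'(k, M) - 1) = 0\<close>, converges to \<open>G k = 0\<close>
  pointwise in \<open>k\<close> (\<open>scaled_barrier_equation_tendsto_G\<close>).

  Pointwise convergence suffices because both sides are monotone: \<open>h\<close> is strictly increasing in
  \<open>k\<close>, hence \<open>G\<close> and \<open>V'\<close> are strictly decreasing.  At \<open>a < k\<^sup>*\<close> we have \<open>G a > 0\<close>,
  so for large \<open>M\<close> the weighted sum of the \<open>V'\<close> exceeds 1 at \<open>a\<close>, and its level-1 point \<open>b(M)\<close> lies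
  to the right of \<open>a\<close>; points \<open>a > k\<^sup>*\<close> are treated in the same way.
\<close>

section \<open>The function h\<close>

lemma lambda_plus_pos:
  assumes "\<mu> > 0" "\<sigma> > 0" "r > 0"
  shows "lambda_plus \<mu> \<sigma> r > 0"
proof -
  have "sqrt (\<mu>\<^sup>2) < sqrt (\<mu>\<^sup>2 + 2 * \<sigma>\<^sup>2 * r)"
    using assms by (intro real_sqrt_less_mono) simp
  thus ?thesis using assms by (simp add: lambda_plus_def)
qed

lemma lambda_minus_neg:
  assumes "\<mu> > 0" "\<sigma> > 0" "r > 0"
  shows "lambda_minus \<mu> \<sigma> r < 0"
proof -
  have "0 \<le> sqrt (\<mu>\<^sup>2 + 2 * \<sigma>\<^sup>2 * r)" using assms by simp
  hence "- \<mu> - sqrt (\<mu>\<^sup>2 + 2 * \<sigma>\<^sup>2 * r) < 0" using assms(1) by linarith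
  thus ?thesis using assms by (simp add: lambda_minus_def divide_neg_pos)
qed

lemma h_denominator_pos:
  assumes "\<mu> > 0" "\<sigma> > 0" "r > 0"
  shows "lambda_plus \<mu> \<sigma> r * exp (lambda_plus \<mu> \<sigma> r * k)
          - lambda_minus \<mu> \<sigma> r * exp (lambda_minus \<mu> \<sigma> r * k) > 0"
proof -
  have "lambda_plus \<mu> \<sigma> r * exp (lambda_plus \<mu> \<sigma> r * k) > 0"
    using lambda_plus_pos[OF assms] by simp
  moreover have "lambda_minus \<mu> \<sigma> r * exp (lambda_minus \<mu> \<sigma> r * k) < 0"
    using lambda_minus_neg[OF assms] by (simp add: mult_neg_pos)
  ultimately show ?thesis by linarith
qed

lemma h_nonneg:
  assumes "\<mu> > 0" "\<sigma> > 0" "r > 0" "k \<ge> 0"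
  shows "h \<mu> \<sigma> k r \<ge> 0"
proof -
  have "lambda_minus \<mu> \<sigma> r * k \<le> lambda_plus \<mu> \<sigma> r * k"
    using lambda_plus_pos[OF assms(1-3)] lambda_minus_neg[OF assms(1-3)] assms(4)
    by (intro mult_right_mono) auto
  thus ?thesis
    unfolding h_def using h_denominator_pos[OF assms(1-3), of k] by (intro divide_nonneg_pos) auto
qed

text \<open>Dividing by \<open>e\<^bsup>\<lambda>\<^sub>+ k\<^esup>\<close> turns \<open>h\<close> into a Moebius function of
  \<open>q = e\<^bsup>(\<lambda>\<^sub>- - \<lambda>\<^sub>+) k\<^esup>\<close>, namely \<open>(1 - q) / (\<lambda>\<^sub>+ - \<lambda>\<^sub>- q)\<close>.  Since \<open>\<lambda>\<^sub>- < 0 < \<lambda>\<^sub>+\<close>, it decreases in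
  \<open>q\<close>, which decreases in \<open>k\<close>.\<close>

lemma h_strict_mono:
  assumes "\<mu> > 0" "\<sigma> > 0" "r > 0" "k < k'"
  shows "h \<mu> \<sigma> k r < h \<mu> \<sigma> k' r"
proof -
  define p where "p = lambda_plus \<mu> \<sigma> r"
  define m where "m = lambda_minus \<mu> \<sigma> r"
  define q where "q x = exp ((m - p) * x)" for x
  have pm: "p > 0" "m < 0"
    using lambda_plus_pos lambda_minus_neg assms by (auto simp: p_def m_def)
  have q_pos: "q x > 0" for x by (simp add: q_def)
  have den: "p - m * q x > 0" for x
    using pm q_pos[of x] mult_neg_pos[of m "q x"] by linarith
  have h_q: "h \<mu> \<sigma> x r = (1 - q x) / (p - m * q x)" for x
  proof -
    have e: "exp (m * x) = exp (p * x) * q x"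
      by (simp add: q_def flip: exp_add) (simp add: algebra_simps)
    have "h \<mu> \<sigma> x r = (exp (p * x) * (1 - q x)) / (exp (p * x) * (p - m * q x))"
      unfolding h_def p_def[symmetric] m_def[symmetric] e by (simp add: algebra_simps)
    thus ?thesis by simp
  qed
  have "q k' < q k" using assms(4) pm by (simp add: q_def)
  hence "(p - m) * q k' < (p - m) * q k" using pm by simp
  hence "(1 - q k) * (p - m * q k') < (1 - q k') * (p - m * q k)"
    by (simp add: algebra_simps)
  thus ?thesis unfolding h_q using den[of k] den[of k'] by (simp add: divide_simps)
qed

lemma G_strict_antimono:
  assumes "\<mu> > 0" "\<sigma> > 0" "N \<ge> 1"
    and "\<And>i. i \<in> {1..N} \<Longrightarrow> \<delta> i > 0" "\<And>i. i \<in> {1..N} \<Longrightarrow> \<omega> i > 0"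
    and "k < k'"
  shows "G \<mu> \<sigma> N \<omega> \<delta> k' < G \<mu> \<sigma> N \<omega> \<delta> k"
  unfolding G_def using assms h_strict_mono[of \<mu> \<sigma> _ k k'] by (intro sum_strict_mono) auto

section \<open>The exponent theta3 for large rate bounds\<close>

lemma theta3_pos_and_root:
  assumes "\<sigma> > 0" "d > 0"
  shows "theta3 \<mu> \<sigma> M d > 0"
    and "M * theta3 \<mu> \<sigma> M d = d + \<mu> * theta3 \<mu> \<sigma> M d - \<sigma>\<^sup>2 / 2 * (theta3 \<mu> \<sigma> M d)\<^sup>2"
  using theI'[OF theta3_ex1[OF assms, of \<mu> M]]
  by (auto simp: theta3_def algebra_simps)

text \<open>Dropping the square in the quadratic equation bounds the root by \<open>d / (M - \<mu>)\<close>.\<close>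

lemma theta3_tendsto_0:
  assumes "\<sigma> > 0" "d > 0"
  shows "((\<lambda>M. theta3 \<mu> \<sigma> M d) \<longlongrightarrow> 0) at_top"
proof (rule tendsto_sandwich[OF _ _ tendsto_const])
  show "\<forall>\<^sub>F M in at_top. 0 \<le> theta3 \<mu> \<sigma> M d"
    using theta3_pos_and_root(1)[OF assms] by (simp add: less_imp_le)
  show "\<forall>\<^sub>F M in at_top. theta3 \<mu> \<sigma> M d \<le> d / (M - \<mu>)"
    using eventually_gt_at_top[of \<mu>]
  proof eventually_elim
    case (elim M)
    have "0 \<le> \<sigma>\<^sup>2 / 2 * (theta3 \<mu> \<sigma> M d)\<^sup>2" by simp
    hence "M * theta3 \<mu> \<sigma> M d \<le> d + \<mu> * theta3 \<mu> \<sigma> M d"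
      using theta3_pos_and_root(2)[OF assms, of M \<mu>] by linarith
    hence "theta3 \<mu> \<sigma> M d * (M - \<mu>) \<le> d" by (simp add: algebra_simps)
    thus ?case using elim by (simp add: pos_le_divide_eq)
  qed
  have "filterlim (\<lambda>M. - \<mu> + M) at_top at_top"
    by (rule filterlim_tendsto_add_at_top[OF tendsto_const filterlim_ident])
  hence "filterlim (\<lambda>M. M - \<mu>) at_top at_top" by simp
  thus "((\<lambda>M. d / (M - \<mu>)) \<longlongrightarrow> 0) at_top"
    by (intro tendsto_divide_0[OF tendsto_const] filterlim_at_top_imp_at_infinity)
qed

lemma M_theta3_tendsto:
  assumes "\<sigma> > 0" "d > 0"
  shows "((\<lambda>M. M * theta3 \<mu> \<sigma> M d) \<longlongrightarrow> d) at_top"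
proof -
  have "((\<lambda>M. d + \<mu> * theta3 \<mu> \<sigma> M d - \<sigma>\<^sup>2 / 2 * (theta3 \<mu> \<sigma> M d)\<^sup>2)
          \<longlongrightarrow> d + \<mu> * 0 - \<sigma>\<^sup>2 / 2 * 0\<^sup>2) at_top"
    by (intro tendsto_intros theta3_tendsto_0 assms)
  thus ?thesis by (simp add: theta3_pos_and_root(2)[OF assms])
qed

section \<open>The bounded-rate barrier equation\<close>

text \<open>The denominator of \<open>V_deriv\<close> is that of \<open>h\<close> plus \<open>\<theta>\<close> times the numerator of \<open>h\<close>, so the
  barrier enters \<open>V_deriv\<close> only through \<open>h\<close>.\<close>

lemma V_deriv_eq:
  assumes "\<mu> > 0" "\<sigma> > 0" "d > 0"
  shows "V_deriv \<mu> \<sigma> d k M =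
    (M * theta3 \<mu> \<sigma> M d / d) / (1 + theta3 \<mu> \<sigma> M d * h \<mu> \<sigma> k d)"
proof -
  define p where "p = lambda_plus \<mu> \<sigma> d"
  define m where "m = lambda_minus \<mu> \<sigma> d"
  define t where "t = theta3 \<mu> \<sigma> M d"
  define A where "A = p * exp (p * k) - m * exp (m * k)"
  define B where "B = exp (p * k) - exp (m * k)"
  have A: "A \<noteq> 0"
    using h_denominator_pos[OF assms, of k] by (simp add: A_def p_def m_def)
  have "(p + t) * exp (p * k) - (m + t) * exp (m * k) = A * (1 + t * (B / A))"
    using A by (simp add: A_def B_def field_simps)
  hence "V_deriv \<mu> \<sigma> d k M = M * t / d * (A / (A * (1 + t * (B / A))))"
    by (simp add: V_deriv_def p_def m_def t_def A_def)
  also have "\<dots> = (M * t / d) / (1 + t * (B / A))" using A by simp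
  finally show ?thesis by (simp add: h_def A_def B_def p_def m_def t_def)
qed

lemma V_deriv_antimono:
  assumes "\<mu> > 0" "\<sigma> > 0" "d > 0" "M \<ge> 0" "0 \<le> k" "k \<le> k'"
  shows "V_deriv \<mu> \<sigma> d k' M \<le> V_deriv \<mu> \<sigma> d k M"
proof -
  have t: "theta3 \<mu> \<sigma> M d > 0" using theta3_pos_and_root(1) assms by simp
  have "h \<mu> \<sigma> k d \<le> h \<mu> \<sigma> k' d"
    using h_strict_mono[of \<mu> \<sigma> d k k'] assms by (cases "k = k'") auto
  hence "1 + theta3 \<mu> \<sigma> M d * h \<mu> \<sigma> k d \<le> 1 + theta3 \<mu> \<sigma> M d * h \<mu> \<sigma> k' d"
    using t by simp
  moreover have "0 < 1 + theta3 \<mu> \<sigma> M d * h \<mu> \<sigma> k' d"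
    using t h_nonneg[of \<mu> \<sigma> d k'] assms by (simp add: add_pos_nonneg)
  moreover have "0 < 1 + theta3 \<mu> \<sigma> M d * h \<mu> \<sigma> k d"
    using t h_nonneg[of \<mu> \<sigma> d k] assms by (simp add: add_pos_nonneg)
  ultimately show ?thesis
    unfolding V_deriv_eq[OF assms(1-3)] using t assms
    by (intro divide_left_mono mult_pos_pos) auto
qed

text \<open>Since \<open>V_deriv\<close> tends to 1 at every barrier, the limiting equation is only visible in the
  deviation from 1, which is of order \<open>1 / M\<close>.\<close>

lemma scaled_V_deriv_tendsto:
  assumes "\<mu> > 0" "\<sigma> > 0" "d > 0" "k \<ge> 0"
  shows "((\<lambda>M. M * (V_deriv \<mu> \<sigma> d k M - 1)) \<longlongrightarrow> \<mu> - d * h \<mu> \<sigma> k d) at_top"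
proof -
  define H where "H = h \<mu> \<sigma> k d"
  define t where "t M = theta3 \<mu> \<sigma> M d" for M
  have H: "H \<ge> 0" using h_nonneg assms by (simp add: H_def)
  have eq: "M * (V_deriv \<mu> \<sigma> d k M - 1) =
      M * t M / d * (\<mu> - d * H - \<sigma>\<^sup>2 / 2 * t M) / (1 + t M * H)" for M
  proof -
    have root: "M * t M = d + \<mu> * t M - \<sigma>\<^sup>2 / 2 * (t M)\<^sup>2"
      using theta3_pos_and_root(2)[of \<sigma> d M \<mu>] assms by (simp add: t_def)
    have "t M > 0" using theta3_pos_and_root(1) assms by (simp add: t_def)
    hence nz: "1 + t M * H \<noteq> 0" using H by (simp add: add_pos_nonneg less_imp_neq[symmetric])
    have "V_deriv \<mu> \<sigma> d k M - 1 = (M * t M / d - (1 + t M * H)) / (1 + t M * H)"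
      using nz by (simp add: V_deriv_eq[OF assms(1-3)] H_def t_def diff_divide_distrib)
    also have "M * t M / d - (1 + t M * H) = t M / d * (\<mu> - d * H - \<sigma>\<^sup>2 / 2 * t M)"
      unfolding root using assms by (simp add: field_simps power2_eq_square)
    finally show ?thesis by simp
  qed
  have t0: "(t \<longlongrightarrow> 0) at_top"
    unfolding t_def using theta3_tendsto_0[OF assms(2,3)] .
  have Mt: "((\<lambda>M. M * t M) \<longlongrightarrow> d) at_top"
    unfolding t_def using M_theta3_tendsto[OF assms(2,3)] .
  have "((\<lambda>M. M * t M / d * (\<mu> - d * H - \<sigma>\<^sup>2 / 2 * t M) / (1 + t M * H))
      \<longlongrightarrow> d / d * (\<mu> - d * H - \<sigma>\<^sup>2 / 2 * 0) / (1 + 0 * H)) at_top"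
    using assms(3) by (intro tendsto_intros t0 Mt) auto
  thus ?thesis using assms(3) by (simp add: eq H_def)
qed

lemma scaled_barrier_equation_tendsto_G:
  assumes "\<mu> > 0" "\<sigma> > 0" "k \<ge> 0"
    and "\<And>i. i \<in> {1..N} \<Longrightarrow> \<delta> i > 0" "(\<Sum>i = 1..N. \<omega> i) = 1"
  shows "((\<lambda>M. M * ((\<Sum>i = 1..N. \<omega> i * V_deriv \<mu> \<sigma> (\<delta> i) k M) - 1))
          \<longlongrightarrow> G \<mu> \<sigma> N \<omega> \<delta> k) at_top"
proof -
  have "(\<Sum>i = 1..N. \<omega> i * V_deriv \<mu> \<sigma> (\<delta> i) k M) - 1
      = (\<Sum>i = 1..N. \<omega> i * (V_deriv \<mu> \<sigma> (\<delta> i) k M - 1))" for M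
    using assms(5) by (simp add: right_diff_distrib sum_subtractf)
  hence "M * ((\<Sum>i = 1..N. \<omega> i * V_deriv \<mu> \<sigma> (\<delta> i) k M) - 1)
      = (\<Sum>i = 1..N. \<omega> i * (M * (V_deriv \<mu> \<sigma> (\<delta> i) k M - 1)))" for M
    by (simp add: sum_distrib_left mult.left_commute)
  thus ?thesis
    unfolding G_def using assms by (auto intro!: tendsto_intros scaled_V_deriv_tendsto)
qed

section \<open>Convergence of the barriers\<close>

theorem theorem5p9:
  fixes \<mu> \<sigma> :: real and N :: nat and \<delta> \<omega> :: "nat \<Rightarrow> real"
    and b :: "real \<Rightarrow> real" and kstar :: real
  assumes "\<mu> > 0" and "\<sigma> > 0" and "N \<ge> 1"
    and "\<And>i. i \<in> {1..N} \<Longrightarrow> \<delta> i > 0"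
    and "\<And>i. i \<in> {1..N} \<Longrightarrow> \<omega> i > 0"
    and "(\<Sum>i = 1..N. \<omega> i) = 1"
    and "\<forall>\<^sub>F M in at_top. bounded_rate_barrier \<mu> \<sigma> N \<omega> \<delta> M (b M)"
    and "singular_barrier \<mu> \<sigma> N \<omega> \<delta> kstar"
  shows "(b \<longlongrightarrow> kstar) at_top"
proof -
  define S where "S k M = (\<Sum>i = 1..N. \<omega> i * V_deriv \<mu> \<sigma> (\<delta> i) k M)" for k M
  have kstar: "kstar > 0" "G \<mu> \<sigma> N \<omega> \<delta> kstar = 0"
    using assms(8) by (auto simp: singular_barrier_def)
  have b: "\<forall>\<^sub>F M in at_top. b M > 0 \<and> S (b M) M = 1"
    using assms(7) by eventually_elim (simp add: bounded_rate_barrier_def S_def)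
  have lim: "((\<lambda>M. M * (S k M - 1)) \<longlongrightarrow> G \<mu> \<sigma> N \<omega> \<delta> k) at_top" if "k \<ge> 0" for k
    unfolding S_def using that assms by (intro scaled_barrier_equation_tendsto_G) auto
  have S_antimono: "S k' M \<le> S k M" if "M \<ge> 0" "0 \<le> k" "k \<le> k'" for k k' M
    unfolding S_def using that assms
    by (intro sum_mono mult_left_mono V_deriv_antimono) (auto intro: less_imp_le)
  show ?thesis
  proof (rule order_tendstoI)
    fix a assume a: "a < kstar"
    \<comment> \<open>Clipping at 0 keeps the comparison point in the range where the \<open>V_deriv\<close> decrease.\<close>
    define a' where "a' = max a 0"
    have "a' < kstar" using a kstar by (simp add: a'_def)
    hence "0 < G \<mu> \<sigma> N \<omega> \<delta> a'"
      using G_strict_antimono[of \<mu> \<sigma> N \<delta> \<omega> a' kstar, OF assms(1-5)] kstar by simp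
    hence "\<forall>\<^sub>F M in at_top. 0 < M * (S a' M - 1)"
      using order_tendstoD(1)[OF lim] by (simp add: a'_def)
    with b eventually_gt_at_top[of 0] show "\<forall>\<^sub>F M in at_top. a < b M"
    proof eventually_elim
      case (elim M)
      hence "S (b M) M < S a' M" by (simp add: zero_less_mult_iff)
      hence "\<not> b M \<le> a'" using S_antimono[of M "b M" a'] elim by auto
      thus ?case by (simp add: a'_def)
    qed
  next
    fix a assume a: "kstar < a"
    hence "G \<mu> \<sigma> N \<omega> \<delta> a < 0"
      using G_strict_antimono[of \<mu> \<sigma> N \<delta> \<omega> kstar a, OF assms(1-5)] a kstar by simp
    hence "\<forall>\<^sub>F M in at_top. M * (S a M - 1) < 0"
      using order_tendstoD(2)[OF lim] a kstar by simp
    with b eventually_gt_at_top[of 0] show "\<forall>\<^sub>F M in at_top. b M < a"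
    proof eventually_elim
      case (elim M)
      hence "S a M < S (b M) M" by (simp add: mult_less_0_iff)
      hence "\<not> a \<le> b M" using S_antimono[of M a "b M"] a kstar elim by auto
      thus ?case by simp
    qed
  qed
qed

end
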